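(* Let $Z$ be a random vector in $\mathbb{R}^d$, let $A\in\mathbb{R}^{m\times d}$ have full row rank, and put $P_\perp:=A^\top(AA^\top)^{-1}A$ and $B:=P_\perp Z$. Let $X_t:=Z+W_t$ with $W$ a standard Brownian motion in $\mathbb{R}^d$ independent of $Z$. For a level $b$ and $t>0$ let $p_t^{*,b}$ be the density of the conditional law of $X_t$ given $B=b$, and $s_t^{*,b}(x):=\nabla_x\log p_t^{*,b}(x)$. Then for every $t>0$ and $x\in\mathbb{R}^d$, $$P_\perp s_t^{*,b}(x)=\frac1t\,P_\perp(b-x).$$
   Context: Conditional laws given $B=b$ are taken with respect to a regular conditional distribution of $Z$ given $B$, for values $b$ such that $P_\perp Z=b$ almost surely under that conditional law (this holds for $\mathrm{Law}(B)$-almost every $b$). Thus $p_t^{*,b}$ is the density of $\mathrm{Law}(Z\mid B=b)*\mathcal{N}(0,tI_d)$. *)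

theory Defs
  imports "HOL-Probability.Probability"
begin

text \<open>For \<open>A\<close> of full row rank, \<open>A ** transpose A\<close> is invertible and this is the matrix
  \<open>P\<^sub>\<bottom>\<close> of the orthogonal projection onto the row space of \<open>A\<close>.\<close>

definition P_perp :: "real ^ 'd ^ 'm \<Rightarrow> real ^ 'd ^ 'd" where
  "P_perp A = transpose A ** matrix_inv (A ** transpose A) ** A"

text \<open>The law \<open>N(0, t I)\<close> on \<open>\<real>\<^sup>d\<close> for \<open>t > 0\<close>; the second argument of
  \<^const>\<open>normal_density\<close> is the standard deviation.\<close>

definition gaussian :: "real \<Rightarrow> (real ^ 'd) measure" where
  "gaussian t = density lborel (\<lambda>x. ennreal (\<Prod>i\<in>UNIV. normal_density 0 (sqrt t) (x $ i)))"

text \<open>Only the values \<open>W t\<close> with \<open>t \<ge> 0\<close> matter.\<close>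

definition standard_brownian_motion :: "'a measure \<Rightarrow> (real \<Rightarrow> 'a \<Rightarrow> real ^ 'd) \<Rightarrow> bool" where
  "standard_brownian_motion M W \<longleftrightarrow>
     (\<forall>t\<ge>0. W t \<in> borel_measurable M) \<and>
     (AE \<omega> in M. W 0 \<omega> = 0) \<and>
     (\<forall>(\<tau> :: nat \<Rightarrow> real) n. 0 \<le> \<tau> 0 \<and> strict_mono \<tau> \<longrightarrow>
        prob_space.indep_vars M (\<lambda>_. borel) (\<lambda>i \<omega>. W (\<tau> (Suc i)) \<omega> - W (\<tau> i) \<omega>) {..<n}) \<and>
     (\<forall>s t. 0 \<le> s \<and> s < t \<longrightarrow> distr M borel (\<lambda>\<omega>. W t \<omega> - W s \<omega>) = gaussian (t - s)) \<and>
     (AE \<omega> in M. continuous_on {0..} (\<lambda>t. W t \<omega>))"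

text \<open>The whole path of \<open>W\<close>, as a random element of the product space over \<open>[0, \<infinity>)\<close>, is
  independent of \<open>Z\<close>. (\<^const>\<open>prob_space.indep_var\<close> needs both variables to have the same type.)\<close>

definition process_indep_of ::
  "'a measure \<Rightarrow> (real \<Rightarrow> 'a \<Rightarrow> real ^ 'd) \<Rightarrow> ('a \<Rightarrow> real ^ 'd) \<Rightarrow> bool" where
  "process_indep_of M W Z \<longleftrightarrow>
     prob_space.indep_set M
       (sets (vimage_algebra (space M) Z borel))
       (sets (vimage_algebra (space M) (\<lambda>\<omega>. \<lambda>t\<in>{0..}. W t \<omega>) (\<Pi>\<^sub>M t\<in>{0..}. borel)))"

text \<open>\<open>\<kappa>\<close> is a probability kernel with \<open>\<kappa> (B \<omega>) C = P(Y \<in> C | \<sigma>(B)) (\<omega>)\<close> almost surely.\<close>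

definition regular_conditional_distribution ::
  "'a measure \<Rightarrow> ('a \<Rightarrow> 'b::topological_space) \<Rightarrow> ('a \<Rightarrow> 'c::topological_space) \<Rightarrow>
   ('c \<Rightarrow> 'b measure) \<Rightarrow> bool" where
  "regular_conditional_distribution M Y B \<kappa> \<longleftrightarrow>
     \<kappa> \<in> borel \<rightarrow>\<^sub>M prob_algebra borel \<and>
     (\<forall>C\<in>sets borel. AE \<omega> in M.
        measure (\<kappa> (B \<omega>)) C
          = real_cond_exp M (vimage_algebra (space M) B borel) (\<lambda>\<omega>'. indicator C (Y \<omega>')) \<omega>)"

text \<open>Lebesgue densities are only determined almost everywhere; pointwise statements about a
  density refer to its continuous version, which is unique.\<close>

definition continuous_density :: "(real ^ 'd) measure \<Rightarrow> (real ^ 'd \<Rightarrow> real) \<Rightarrow> bool" where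
  "continuous_density \<mu> p \<longleftrightarrow>
     continuous_on UNIV p \<and> (\<forall>x. 0 \<le> p x) \<and> \<mu> = density lborel (\<lambda>x. ennreal (p x))"

definition gradient :: "('a::real_inner \<Rightarrow> real) \<Rightarrow> 'a \<Rightarrow> 'a" where
  "gradient f x = (THE D. GDERIV f x :> D)"

definition score :: "(real ^ 'd \<Rightarrow> real) \<Rightarrow> real ^ 'd \<Rightarrow> real ^ 'd" where
  "score p x = gradient (\<lambda>y. ln (p y)) x"

text \<open>The conditional law of \<open>X\<^sub>t = Z + W\<^sub>t\<close> given \<open>B = b\<close>, formed from a regular conditional
  distribution \<open>\<kappa>\<close> of \<open>Z\<close> given \<open>B\<close>: it is \<open>\<kappa> b * N(0, t I)\<close>, because \<open>W\<^sub>t\<close> is independent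
  of \<open>(Z, B)\<close>.\<close>

definition cond_law_X ::
  "(real ^ 'd \<Rightarrow> (real ^ 'd) measure) \<Rightarrow> real \<Rightarrow> real ^ 'd \<Rightarrow> (real ^ 'd) measure" where
  "cond_law_X \<kappa> t b = (\<kappa> b \<star> gaussian t)"

end

theory Submission
  imports Defs
begin

text \<open>Conditionally on \<open>B = b\<close> the density of \<open>X\<^sub>t\<close> is \<open>q x = \<integral> \<phi>\<^sub>t (x - z) \<kappa>\<^sub>b(dz)\<close> with \<open>\<phi>\<^sub>t\<close> the
  density of \<open>N(0, t I)\<close>. Since \<open>\<nabla>\<phi>\<^sub>t y = - (\<phi>\<^sub>t y / t) y\<close> is bounded, one may differentiate under the
  integral, and since \<open>P\<^sub>\<bottom> z = b\<close> for \<open>\<kappa>\<^sub>b\<close>-almost every \<open>z\<close>, the factor \<open>P\<^sub>\<bottom> (z - x) / t\<close> of the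
  projected integrand is the constant \<open>(b - P\<^sub>\<bottom> x) / t\<close>; dividing by \<open>q x\<close> leaves it alone. It equals
  \<open>P\<^sub>\<bottom> (b - x) / t\<close> because \<open>P\<^sub>\<bottom>\<close> is idempotent and \<open>b\<close> lies in its range.\<close>

section \<open>The orthogonal projection onto the row space\<close>

text \<open>The Gram matrix \<open>A ** transpose A\<close> is injective: pairing its value at a
  vector with that vector gives the squared norm of the image under \<open>transpose A\<close>,
  which is injective by full row rank. Its inverse then cancels the inner Gram factor in the square
  of the projection.\<close>

lemma P_perp_idem:
  fixes A :: "real ^ 'd ^ 'm"
  assumes "rank A = CARD('m)"
  shows "P_perp A ** P_perp A = P_perp A"
proof -
  have inj: "inj ((*v) (transpose A))"
    using assms by (simp add: full_rank_injective[symmetric] rank_transpose)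
  have "inj ((*v) (A ** transpose A))"
  proof (rule injI)
    fix x y assume "(A ** transpose A) *v x = (A ** transpose A) *v y"
    then have "A *v (transpose A *v (x - y)) = 0"
      by (simp only: matrix_vector_mul_assoc matrix_vector_mult_diff_distrib) simp
    then have "(x - y) \<bullet> (A *v (transpose A *v (x - y))) = 0"
      by simp
    then have "(transpose A *v (x - y)) \<bullet> (transpose A *v (x - y)) = 0"
      by (simp add: dot_lmul_matrix[symmetric])
    then have "transpose A *v x = transpose A *v y"
      by (simp add: matrix_vector_mult_diff_distrib)
    then show "x = y" using inj by (simp add: inj_def)
  qed
  then have "invertible (A ** transpose A)"
    by (simp add: invertible_left_inverse matrix_left_invertible_injective)
  \<comment> \<open>\<open>matrix_inv\<close> is a choice, so its defining property has to be
    extracted from invertibility.\<close>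
  then have "matrix_inv (A ** transpose A) ** (A ** transpose A) = mat 1"
    unfolding invertible_def matrix_inv_def by (rule someI2_ex) simp
  \<comment> \<open>The trailing factor \<open>X\<close> makes the cancellation applicable inside a
    product associated to the right.\<close>
  then have "matrix_inv (A ** transpose A) ** ((A ** transpose A) ** X) = X" for X :: "real ^ 'd ^ 'm"
    by (metis matrix_mul_assoc matrix_mul_lid)
  then show ?thesis
    by (simp add: P_perp_def matrix_mul_assoc[symmetric])
qed

section \<open>Regular conditional distributions and independent noise\<close>

text \<open>A conditional expectation is characterised by its integrals over the sets of the
  conditioning algebra, and these sets are exactly the preimages under \<open>B\<close> of Borel
  sets \<open>T\<close>. The resulting identity of nonnegative integrals is the form in which
  Tonelli's theorem can be used.\<close>

lemma regular_conditional_distribution_iff: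
  fixes Y :: "'a \<Rightarrow> 'b::topological_space" and B :: "'a \<Rightarrow> 'c::topological_space"
  assumes "prob_space M"
    and Y[measurable]: "Y \<in> borel_measurable M" and B[measurable]: "B \<in> borel_measurable M"
    and K[measurable]: "\<kappa> \<in> borel \<rightarrow>\<^sub>M prob_algebra borel"
  shows "regular_conditional_distribution M Y B \<kappa> \<longleftrightarrow>
    (\<forall>C\<in>sets borel. \<forall>T\<in>sets borel.
      emeasure M {\<omega>\<in>space M. B \<omega> \<in> T \<and> Y \<omega> \<in> C}
        = (\<integral>\<^sup>+\<omega>. indicator T (B \<omega>) * emeasure (\<kappa> (B \<omega>)) C \<partial>M))" (is "_ \<longleftrightarrow> ?R")
proof -
  interpret prob_space M by fact
  let ?F = "vimage_algebra (space M) B borel"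
  have BF[measurable]: "B \<in> ?F \<rightarrow>\<^sub>M borel"
    by (rule measurable_vimage_algebra1) simp
  have sub: "subalgebra M ?F"
    using sets_image_in_sets[of M "space M" B borel] B by (auto simp: subalgebra_def)
  interpret finite_measure_subalgebra M ?F
    by unfold_locales (rule sub)
  have ps: "prob_space (\<kappa> x)" and sK: "sets (\<kappa> x) = sets borel" for x
    using measurable_space[OF K, of x] by (auto simp: space_prob_algebra)
  \<comment> \<open>Facts \<open>1\<close> and \<open>2\<close> translate the two set integrals over
    the preimage of \<open>T\<close> into the two sides of \<open>?R\<close>.\<close>
  have 1: "(\<integral>\<omega>\<in>B -` T \<inter> space M. indicator C (Y \<omega>) \<partial>M) = measure M {\<omega>\<in>space M. B \<omega> \<in> T \<and> Y \<omega> \<in> C}"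
    if [measurable]: "C \<in> sets borel" "T \<in> sets borel" for C T
  proof -
    have "(\<integral>\<omega>\<in>B -` T \<inter> space M. indicat_real C (Y \<omega>) \<partial>M)
      = (\<integral>\<omega>. indicator {\<omega>\<in>space M. B \<omega> \<in> T \<and> Y \<omega> \<in> C} \<omega> \<partial>M)"
      unfolding set_lebesgue_integral_def
      by (intro Bochner_Integration.integral_cong) (auto simp: indicator_def)
    then show ?thesis by simp
  qed
  have m[measurable]: "(\<lambda>\<omega>. measure (\<kappa> (B \<omega>)) C) \<in> borel_measurable ?F"
    if [measurable]: "C \<in> sets borel" for C
    by measurable
  have mM[measurable]: "(\<lambda>\<omega>. measure (\<kappa> (B \<omega>)) C) \<in> borel_measurable M"
    if [measurable]: "C \<in> sets borel" for C
    by measurable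
  have iK: "integrable M (\<lambda>\<omega>. measure (\<kappa> (B \<omega>)) C)" if "C \<in> sets borel" for C
    by (rule integrable_const_bound[where B=1])
       (use that ps in \<open>auto intro: prob_space.prob_le_1\<close>)
  have iY: "integrable M (\<lambda>\<omega>. indicator C (Y \<omega>) :: real)" if [measurable]: "C \<in> sets borel" for C
    by (rule integrable_const_bound[where B=1]) (auto simp: indicator_def)
  have 2: "ennreal (\<integral>\<omega>\<in>B -` T \<inter> space M. measure (\<kappa> (B \<omega>)) C \<partial>M)
      = (\<integral>\<^sup>+\<omega>. indicator T (B \<omega>) * emeasure (\<kappa> (B \<omega>)) C \<partial>M)"
    if [measurable]: "C \<in> sets borel" "T \<in> sets borel" for C T
  proof -
    have "integrable M (\<lambda>\<omega>. indicator (B -` T \<inter> space M) \<omega> * measure (\<kappa> (B \<omega>)) C)"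
      by (rule integrable_real_mult_indicator[OF _ iK, unfolded mult.commute[of _ "indicator _ _"]]) auto
    then have "ennreal (\<integral>\<omega>\<in>B -` T \<inter> space M. measure (\<kappa> (B \<omega>)) C \<partial>M)
      = (\<integral>\<^sup>+\<omega>. ennreal (indicator (B -` T \<inter> space M) \<omega> * measure (\<kappa> (B \<omega>)) C) \<partial>M)"
      unfolding set_lebesgue_integral_def
      by (subst nn_integral_eq_integral) (auto simp: indicator_def)
    also have "\<dots> = (\<integral>\<^sup>+\<omega>. indicator T (B \<omega>) * emeasure (\<kappa> (B \<omega>)) C \<partial>M)"
    proof (rule nn_integral_cong)
      fix \<omega> assume "\<omega> \<in> space M"
      interpret k: prob_space "\<kappa> (B \<omega>)" by (rule ps)
      show "ennreal (indicator (B -` T \<inter> space M) \<omega> * measure (\<kappa> (B \<omega>)) C)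
          = indicator T (B \<omega>) * emeasure (\<kappa> (B \<omega>)) C"
        using \<open>\<omega> \<in> space M\<close> by (auto simp: indicator_def k.emeasure_eq_measure)
    qed
    finally show ?thesis .
  qed
  \<comment> \<open>Nonnegativity is what allows \<open>ennreal\<close> to be stripped from an
    equation in the converse direction.\<close>
  have nn: "0 \<le> (\<integral>\<omega>\<in>B -` T \<inter> space M. measure (\<kappa> (B \<omega>)) C \<partial>M)" for T C
    unfolding set_lebesgue_integral_def by (intro integral_nonneg_AE) auto
  show ?thesis
  proof
    assume rcd: "regular_conditional_distribution M Y B \<kappa>"
    show ?R
    proof (intro ballI)
      fix C :: "'b set" and T :: "'c set" assume [measurable]: "C \<in> sets borel" "T \<in> sets borel"
      let ?S = "B -` T \<inter> space M"
      have S: "?S \<in> sets ?F" by (rule in_vimage_algebra) fact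
      have ae: "AE \<omega> in M. measure (\<kappa> (B \<omega>)) C = real_cond_exp M ?F (\<lambda>\<omega>'. indicator C (Y \<omega>')) \<omega>"
        using rcd by (simp add: regular_conditional_distribution_def)
      have "(\<integral>\<omega>\<in>?S. indicator C (Y \<omega>) \<partial>M) = (\<integral>\<omega>\<in>?S. real_cond_exp M ?F (\<lambda>\<omega>'. indicator C (Y \<omega>')) \<omega> \<partial>M)"
        by (rule real_cond_exp_intA[OF iY S]) fact
      also have "\<dots> = (\<integral>\<omega>\<in>?S. measure (\<kappa> (B \<omega>)) C \<partial>M)"
        unfolding set_lebesgue_integral_def
        by (rule integral_cong_AE) (use ae in \<open>auto\<close>)
      finally show "emeasure M {\<omega>\<in>space M. B \<omega> \<in> T \<and> Y \<omega> \<in> C}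
        = (\<integral>\<^sup>+\<omega>. indicator T (B \<omega>) * emeasure (\<kappa> (B \<omega>)) C \<partial>M)"
        by (simp add: 1 2[symmetric] emeasure_eq_measure)
    qed
  next
    assume R: ?R
    show "regular_conditional_distribution M Y B \<kappa>"
      unfolding regular_conditional_distribution_def
    proof (intro conjI ballI K)
      fix C :: "'b set" assume C[measurable]: "C \<in> sets borel"
      have "AE \<omega> in M. real_cond_exp M ?F (\<lambda>\<omega>'. indicator C (Y \<omega>')) \<omega> = measure (\<kappa> (B \<omega>)) C"
      proof (rule real_cond_exp_charact)
        fix S assume "S \<in> sets ?F"
        then obtain T where T[measurable]: "T \<in> sets borel" and S: "S = B -` T \<inter> space M"
          by (auto simp: sets_vimage_algebra2)
        have "ennreal (measure M {\<omega>\<in>space M. B \<omega> \<in> T \<and> Y \<omega> \<in> C})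
            = ennreal (\<integral>\<omega>\<in>S. measure (\<kappa> (B \<omega>)) C \<partial>M)"
          using R C T by (simp add: S 2 emeasure_eq_measure[symmetric])
        then show "(\<integral>\<omega>\<in>S. indicator C (Y \<omega>) \<partial>M) = (\<integral>\<omega>\<in>S. measure (\<kappa> (B \<omega>)) C \<partial>M)"
          using nn[of T C] by (simp add: S 1)
      qed (auto simp: iK iY)
      then show "AE \<omega> in M. measure (\<kappa> (B \<omega>)) C = real_cond_exp M ?F (\<lambda>\<omega>'. indicator C (Y \<omega>')) \<omega>"
        by eventually_elim simp
    qed
  qed
qed

text \<open>For a fixed value \<open>w\<close> of the noise, \<open>Z + w\<close> falling into
  \<open>C\<close> is an event about \<open>Z\<close> alone, so the disintegration of
  \<open>Z\<close> applies to the translated set. Averaging over \<open>w\<close> and exchanging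
  integrals turns the translates of the kernel into its convolution with the law of
  \<open>V\<close>.\<close>

lemma regular_conditional_distribution_add_indep:
  fixes Z V :: "'a \<Rightarrow> 'b::ordered_euclidean_space" and h :: "'b \<Rightarrow> 'c::topological_space"
  assumes "prob_space M"
    and ind: "prob_space.indep_var M borel Z borel V"
    and h[measurable]: "h \<in> borel \<rightarrow>\<^sub>M borel"
    and rcd: "regular_conditional_distribution M Z (\<lambda>\<omega>. h (Z \<omega>)) \<kappa>"
  shows "regular_conditional_distribution M (\<lambda>\<omega>. Z \<omega> + V \<omega>) (\<lambda>\<omega>. h (Z \<omega>)) (\<lambda>b. \<kappa> b \<star> distr M borel V)"
proof -
  interpret prob_space M by fact
  let ?\<nu> = "distr M borel V"
  have Z[measurable]: "Z \<in> borel_measurable M" and V[measurable]: "V \<in> borel_measurable M"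
    and joint: "distr M borel Z \<Otimes>\<^sub>M ?\<nu> = distr M (borel \<Otimes>\<^sub>M borel) (\<lambda>\<omega>. (Z \<omega>, V \<omega>))"
    using ind by (auto simp: indep_var_distribution_eq)
  have K[measurable]: "\<kappa> \<in> borel \<rightarrow>\<^sub>M prob_algebra borel"
    using rcd by (simp add: regular_conditional_distribution_def)
  have ps: "prob_space (\<kappa> x)" and sK: "sets (\<kappa> x) = sets borel" for x
    using measurable_space[OF K, of x] by (auto simp: space_prob_algebra)
  interpret V: prob_space ?\<nu> by (rule prob_space_distr) simp
  interpret Z: prob_space "distr M borel Z" by (rule prob_space_distr) simp
  interpret ZV: pair_prob_space "distr M borel Z" ?\<nu> ..
  interpret MV: pair_prob_space M ?\<nu> ..
  have conv[measurable]: "(\<lambda>b. \<kappa> b \<star> ?\<nu>) \<in> borel \<rightarrow>\<^sub>M prob_algebra borel"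
  proof -
    have [measurable]: "(\<lambda>b::'c. ?\<nu>) \<in> borel \<rightarrow>\<^sub>M prob_algebra borel"
      by (rule measurable_const) (simp add: space_prob_algebra V.prob_space_axioms)
    show ?thesis unfolding convolution_def by measurable
  qed
  have split: "emeasure M {\<omega>\<in>space M. h (Z \<omega>) \<in> T \<and> Z \<omega> \<in> D}
      = (\<integral>\<^sup>+\<omega>. indicator T (h (Z \<omega>)) * emeasure (\<kappa> (h (Z \<omega>))) D \<partial>M)"
    if "D \<in> sets borel" "T \<in> sets borel" for D T
    using rcd that by (subst (asm) regular_conditional_distribution_iff) (auto intro: \<open>prob_space M\<close>)
  show ?thesis
  proof (subst regular_conditional_distribution_iff, goal_cases)
    case 5
    show ?case
    proof (intro ballI)
      fix C :: "'b set" and T :: "'c set"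
      assume C[measurable]: "C \<in> sets borel" and T[measurable]: "T \<in> sets borel"
      have Cw[measurable]: "{z. z + w \<in> C} \<in> sets borel" for w
        using measurable_sets[of "\<lambda>z. z + w" borel borel C] by (simp add: vimage_def)
      have "emeasure M {\<omega>\<in>space M. h (Z \<omega>) \<in> T \<and> Z \<omega> + V \<omega> \<in> C}
          = (\<integral>\<^sup>+\<omega>. indicator {\<omega>\<in>space M. h (Z \<omega>) \<in> T \<and> Z \<omega> + V \<omega> \<in> C} \<omega> \<partial>M)"
        by simp
      also have "\<dots> = (\<integral>\<^sup>+\<omega>. indicator T (h (Z \<omega>)) * indicator C (Z \<omega> + V \<omega>) \<partial>M)"
        by (rule nn_integral_cong) (simp add: indicator_def)
      \<comment> \<open>The integrand depends on the pair \<open>(Z, V)\<close> only, whose law is a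
        product by independence.\<close>
      also have "\<dots> = (\<integral>\<^sup>+p. (\<lambda>(z, w). indicator T (h z) * indicator C (z + w)) p
          \<partial>distr M (borel \<Otimes>\<^sub>M borel) (\<lambda>\<omega>. (Z \<omega>, V \<omega>)))"
        by (subst nn_integral_distr) auto
      also have "\<dots> = (\<integral>\<^sup>+w. \<integral>\<^sup>+z. indicator T (h z) * indicator C (z + w) \<partial>distr M borel Z \<partial>?\<nu>)"
        unfolding joint[symmetric] by (subst ZV.nn_integral_snd[symmetric]) auto
      also have "\<dots> = (\<integral>\<^sup>+w. emeasure M {\<omega>\<in>space M. h (Z \<omega>) \<in> T \<and> Z \<omega> \<in> {z. z + w \<in> C}} \<partial>?\<nu>)"
      proof (rule nn_integral_cong)
        fix w
        have "(\<integral>\<^sup>+z. indicator T (h z) * indicator C (z + w) \<partial>distr M borel Z)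
            = (\<integral>\<^sup>+\<omega>. indicator {\<omega>\<in>space M. h (Z \<omega>) \<in> T \<and> Z \<omega> \<in> {z. z + w \<in> C}} \<omega> \<partial>M)"
          by (subst nn_integral_distr, simp, simp, rule nn_integral_cong) (simp add: indicator_def)
        then show "(\<integral>\<^sup>+z. indicator T (h z) * indicator C (z + w) \<partial>distr M borel Z)
            = emeasure M {\<omega>\<in>space M. h (Z \<omega>) \<in> T \<and> Z \<omega> \<in> {z. z + w \<in> C}}"
          by (subst (asm) nn_integral_indicator) auto
      qed
      also have "\<dots> = (\<integral>\<^sup>+w. \<integral>\<^sup>+\<omega>. indicator T (h (Z \<omega>)) * emeasure (\<kappa> (h (Z \<omega>))) {z. z + w \<in> C} \<partial>M \<partial>?\<nu>)"
        by (simp only: split[OF Cw T])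
      also have "\<dots> = (\<integral>\<^sup>+\<omega>. \<integral>\<^sup>+w. indicator T (h (Z \<omega>)) * emeasure (\<kappa> (h (Z \<omega>))) {z. z + w \<in> C} \<partial>?\<nu> \<partial>M)"
      proof (rule MV.Fubini')
        \<comment> \<open>Both the measure and the set vary with \<open>p\<close>, so the sets must
          be shown to form a measurable subset of the product.\<close>
        have "(\<lambda>p. emeasure (\<kappa> (h (Z (fst p)))) {z. z + snd p \<in> C}) \<in> borel_measurable (M \<Otimes>\<^sub>M borel)"
        proof (rule emeasure_measurable_subprob_algebra2)
          have "(SIGMA p:space (M \<Otimes>\<^sub>M borel). {z. z + snd p \<in> C})
              = (\<lambda>q. snd q + snd (fst q)) -` C \<inter> space ((M \<Otimes>\<^sub>M borel) \<Otimes>\<^sub>M borel)"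
            by (auto simp: space_pair_measure)
          also have "\<dots> \<in> sets ((M \<Otimes>\<^sub>M borel) \<Otimes>\<^sub>M borel)"
            by measurable
          finally show "(SIGMA p:space (M \<Otimes>\<^sub>M borel). {z. z + snd p \<in> C}) \<in> sets ((M \<Otimes>\<^sub>M borel) \<Otimes>\<^sub>M borel)" .
          show "(\<lambda>p. \<kappa> (h (Z (fst p)))) \<in> M \<Otimes>\<^sub>M borel \<rightarrow>\<^sub>M subprob_algebra borel"
            by (rule measurable_prob_algebraD) measurable
        qed
        then show "(\<lambda>(\<omega>, w). indicator T (h (Z \<omega>)) * emeasure (\<kappa> (h (Z \<omega>))) {z. z + w \<in> C})
            \<in> borel_measurable (M \<Otimes>\<^sub>M ?\<nu>)"
          by (simp add: case_prod_beta)
      qed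
      also have "\<dots> = (\<integral>\<^sup>+\<omega>. indicator T (h (Z \<omega>)) * emeasure (\<kappa> (h (Z \<omega>)) \<star> ?\<nu>) C \<partial>M)"
      proof (rule nn_integral_cong)
        fix \<omega>
        interpret k: prob_space "\<kappa> (h (Z \<omega>))" by (rule ps)
        \<comment> \<open>\<open>convolution_emeasure\<close> puts the first factor outside;
          commuting makes the noise law the outer integral.\<close>
        have "\<kappa> (h (Z \<omega>)) \<star> ?\<nu> = (?\<nu> \<star> \<kappa> (h (Z \<omega>)))"
          by (rule convolution_commutative) (auto simp: sK k.finite_measure_axioms V.finite_measure_axioms)
        then have "emeasure (\<kappa> (h (Z \<omega>)) \<star> ?\<nu>) C = (\<integral>\<^sup>+w. emeasure (\<kappa> (h (Z \<omega>))) {z. z + w \<in> C} \<partial>?\<nu>)"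
          using sets_eq_imp_space_eq[OF sK]
          by (simp add: convolution_emeasure sK k.finite_measure_axioms V.finite_measure_axioms)
        then show "(\<integral>\<^sup>+w. indicator T (h (Z \<omega>)) * emeasure (\<kappa> (h (Z \<omega>))) {z. z + w \<in> C} \<partial>?\<nu>)
            = indicator T (h (Z \<omega>)) * emeasure (\<kappa> (h (Z \<omega>)) \<star> ?\<nu>) C"
          by (cases "h (Z \<omega>) \<in> T") simp_all
      qed
      finally show "emeasure M {\<omega>\<in>space M. h (Z \<omega>) \<in> T \<and> Z \<omega> + V \<omega> \<in> C}
          = (\<integral>\<^sup>+\<omega>. indicator T (h (Z \<omega>)) * emeasure (\<kappa> (h (Z \<omega>)) \<star> ?\<nu>) C \<partial>M)" .
    qed
  qed (auto intro: \<open>prob_space M\<close>)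
qed

section \<open>Marginals of the Brownian motion and their independence of \<open>Z\<close>\<close>

text \<open>The process starts at 0 almost surely, so \<open>W t\<close> agrees almost surely with
  its increment over \<open>[0, t]\<close>.\<close>

lemma brownian_motion_distr:
  assumes "standard_brownian_motion M W" "0 < t"
  shows "distr M borel (W t) = gaussian t"
proof -
  have [measurable]: "W t \<in> borel_measurable M" "W 0 \<in> borel_measurable M" and "AE \<omega> in M. W 0 \<omega> = 0"
    using assms by (auto simp: standard_brownian_motion_def)
  then have "distr M borel (W t) = distr M borel (\<lambda>\<omega>. W t \<omega> - W 0 \<omega>)"
    by (intro distr_cong_AE) auto
  also have "\<dots> = gaussian (t - 0)"
    using assms unfolding standard_brownian_motion_def by blast
  finally show ?thesis by simp
qed

text \<open>Evaluation at a time \<open>t\<close> is measurable on the path space, so the events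
  generated by \<open>W t\<close> belong to the algebra of the whole path and inherit its
  independence of \<open>Z\<close>.\<close>

lemma process_indep_of_indep_var:
  assumes "prob_space M" "Z \<in> borel_measurable M" "process_indep_of M W Z"
    and W: "\<And>t. 0 \<le> t \<Longrightarrow> W t \<in> borel_measurable M" and "0 \<le> t"
  shows "prob_space.indep_var M borel Z borel (W t)"
proof -
  interpret prob_space M by fact
  let ?P = "\<lambda>\<omega>. \<lambda>t\<in>{0..}. W t \<omega>"
  have ind: "indep_set (sets (vimage_algebra (space M) Z borel))
      (sets (vimage_algebra (space M) ?P (\<Pi>\<^sub>M t\<in>{0..}. borel)))"
    using assms(3) by (simp add: process_indep_of_def)
  have "Z -` S \<inter> space M \<in> sets (vimage_algebra (space M) Z borel)" if "S \<in> sets borel" for S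
    by (rule in_vimage_algebra[OF that])
  moreover have "W t -` S \<inter> space M \<in> sets (vimage_algebra (space M) ?P (\<Pi>\<^sub>M t\<in>{0..}. borel))"
    if S: "S \<in> sets borel" for S
  proof -
    have "(\<lambda>\<omega>. ?P \<omega> t) \<in> vimage_algebra (space M) ?P (\<Pi>\<^sub>M t\<in>{0..}. borel) \<rightarrow>\<^sub>M borel"
      by (rule measurable_compose[OF measurable_vimage_algebra1 measurable_component_singleton])
         (use \<open>0 \<le> t\<close> in \<open>auto simp: space_PiM split: if_splits\<close>)
    from measurable_sets[OF this S] show ?thesis using \<open>0 \<le> t\<close> by simp
  qed
  ultimately have "indep_set {Z -` S \<inter> space M |S. S \<in> sets borel} {W t -` S \<inter> space M |S. S \<in> sets borel}"
    using ind unfolding indep_sets2_eq by blast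
  \<comment> \<open>\<open>indep_var_eq\<close> speaks of generated algebras; preimages of Borel
    sets are closed under intersection, so independence passes to them.\<close>
  then have "indep_set (sigma_sets (space M) {Z -` S \<inter> space M |S. S \<in> sets borel})
      (sigma_sets (space M) {W t -` S \<inter> space M |S. S \<in> sets borel})"
  proof (rule indep_set_sigma_sets)
    have *: "Int_stable {X -` S \<inter> space M |S. S \<in> sets borel}" for X :: "'a \<Rightarrow> real ^ 'b"
    proof (rule Int_stableI, safe)
      fix S T :: "(real ^ 'b) set" assume "S \<in> sets borel" "T \<in> sets borel"
      then show "\<exists>U. (X -` S \<inter> space M) \<inter> (X -` T \<inter> space M) = X -` U \<inter> space M \<and> U \<in> sets borel"
        by (intro exI[of _ "S \<inter> T"]) auto
    qed
    show "Int_stable {Z -` S \<inter> space M |S. S \<in> sets borel}"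
      "Int_stable {W t -` S \<inter> space M |S. S \<in> sets borel}" by (rule *)+
  qed
  then show ?thesis
    using assms by (simp add: indep_var_eq)
qed

section \<open>Gradients and densities of convolutions\<close>

text \<open>This makes the definite description in \<open>gradient\<close> meaningful: two
  candidates have the same inner products with every vector, in particular with
  \<open>D - E\<close>.\<close>

lemma GDERIV_unique:
  assumes "GDERIV f x :> D" "GDERIV f x :> E"
  shows "D = E"
proof -
  have "(\<lambda>h. h \<bullet> D) = (\<lambda>h. h \<bullet> E)"
    using assms unfolding gderiv_def by (rule has_derivative_unique)
  then have "(D - E) \<bullet> D = (D - E) \<bullet> E" by meson
  then have "(D - E) \<bullet> (D - E) = 0" by (simp add: inner_diff_right)
  then show ?thesis by simp
qed

lemma gradient_eqI: "GDERIV f x :> D \<Longrightarrow> gradient f x = D"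
  unfolding gradient_def by (blast intro: the_equality GDERIV_unique)

text \<open>This is the mean value inequality, with the operator norm of the derivative bounded by
  Cauchy-Schwarz. It provides the domination needed to differentiate under the integral.\<close>

lemma GDERIV_bounded_lipschitz:
  fixes f :: "'a::real_inner \<Rightarrow> real"
  assumes f: "\<And>y. GDERIV f y :> g y" and bound: "\<And>y. norm (g y) \<le> C"
  shows "\<bar>f x - f y\<bar> \<le> C * norm (x - y)"
proof -
  have "norm (f x - f y) \<le> C * norm (x - y)"
  proof (rule differentiable_bound[OF convex_UNIV])
    show "(f has_derivative (\<lambda>h. h \<bullet> g y)) (at y within UNIV)" for y
      using f by (simp add: gderiv_def)
    show "onorm (\<lambda>h. h \<bullet> g y) \<le> C" for y
    proof (rule onorm_bound)
      show "0 \<le> C" using bound[of y] norm_ge_zero order_trans by blast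
      fix h
      have "\<bar>h \<bullet> g y\<bar> \<le> norm h * norm (g y)" by (rule Cauchy_Schwarz_ineq2)
      also have "\<dots> \<le> norm h * C" using bound by (intro mult_left_mono) auto
      finally show "norm (h \<bullet> g y) \<le> C * norm h" by (simp add: mult.commute)
    qed
  qed auto
  then show ?thesis by simp
qed

text \<open>The difference quotient remainder \<open>?q\<close> tends to 0 pointwise in
  \<open>z\<close> and is bounded by a constant, which is integrable for a finite measure; dominated
  convergence and linearity of the integral then give the derivative.\<close>

lemma GDERIV_integral_translate:
  fixes f :: "'a::euclidean_space \<Rightarrow> real"
  assumes "finite_measure \<mu>" and sets[measurable_cong]: "sets \<mu> = sets borel"
    and f: "\<And>y. GDERIV f y :> g y"
    and bf: "\<And>y. \<bar>f y\<bar> \<le> C" and bg: "\<And>y. norm (g y) \<le> C"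
    and g[measurable]: "g \<in> borel_measurable borel"
  shows "GDERIV (\<lambda>x. \<integral>z. f (x - z) \<partial>\<mu>) x :> (\<integral>z. g (x - z) \<partial>\<mu>)"
proof -
  interpret finite_measure \<mu> by fact
  have "continuous_on UNIV f"
    using f by (auto simp: gderiv_def intro: continuous_at_imp_continuous_on has_derivative_continuous)
  then have fm[measurable]: "f \<in> borel_measurable borel"
    by (rule borel_measurable_continuous_onI)
  have intf: "integrable \<mu> (\<lambda>z. f (y - z))" for y
    by (rule integrable_const_bound[where B=C]) (auto simp: bf)
  have intg: "integrable \<mu> (\<lambda>z. g (y - z))" for y
    by (rule integrable_const_bound[where B=C]) (auto simp: bg)
  let ?q = "\<lambda>y z. (f (y - z) - f (x - z) - (y - x) \<bullet> g (x - z)) /\<^sub>R norm (y - x)"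
  show ?thesis
    \<comment> \<open>The limit at \<open>x\<close> is tested along sequences avoiding
      \<open>x\<close>, the setting of dominated convergence.\<close>
    unfolding gderiv_def has_derivative_at_within tendsto_at_iff_sequentially
  proof (intro conjI allI impI bounded_linear_inner_left)
    fix X assume X: "\<forall>i. X i \<in> UNIV - {x}" "X \<longlonglongrightarrow> x"
    have "(\<lambda>i. \<integral>z. ?q (X i) z \<partial>\<mu>) \<longlonglongrightarrow> (\<integral>z. 0 \<partial>\<mu>)"
    proof (rule integral_dominated_convergence[where w="\<lambda>_. 2 * C"])
      show "AE z in \<mu>. (\<lambda>i. ?q (X i) z) \<longlonglongrightarrow> 0"
      proof (rule AE_I2)
        fix z
        have "((\<lambda>y. f (y - z)) has_derivative (\<lambda>h. h \<bullet> g (x - z))) (at x)"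
          using f[of "x - z"] unfolding gderiv_def
          by (rule has_derivative_compose[rotated]) (auto intro!: derivative_eq_intros)
        then have "((\<lambda>y. ?q y z) \<longlongrightarrow> 0) (at x)"
          by (simp add: has_derivative_at_within)
        then show "(\<lambda>i. ?q (X i) z) \<longlonglongrightarrow> 0"
          using X by (auto simp: tendsto_at_iff_sequentially o_def)
      qed
      \<comment> \<open>One \<open>C\<close> comes from the Lipschitz bound on the increment of
        \<open>f\<close>, the other from the linear term.\<close>
      show "AE z in \<mu>. norm (?q (X i) z) \<le> 2 * C" for i
      proof (rule AE_I2)
        fix z
        have pos: "norm (X i - x) > 0" using X by auto
        have "\<bar>f (X i - z) - f (x - z)\<bar> \<le> C * norm (X i - x)"
          using GDERIV_bounded_lipschitz[OF f bg, of "X i - z" "x - z"] by simp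
        moreover have "\<bar>(X i - x) \<bullet> g (x - z)\<bar> \<le> C * norm (X i - x)"
          using Cauchy_Schwarz_ineq2[of "X i - x" "g (x - z)"] mult_left_mono[OF bg[of "x - z"], of "norm (X i - x)"]
          by (simp add: mult.commute)
        ultimately have "\<bar>f (X i - z) - f (x - z) - (X i - x) \<bullet> g (x - z)\<bar> \<le> 2 * C * norm (X i - x)"
          by linarith
        then show "norm (?q (X i) z) \<le> 2 * C"
          using pos by (simp add: field_simps abs_mult)
      qed
    qed auto
    moreover have "(\<integral>z. ?q y z \<partial>\<mu>) = ((\<integral>z. f (y - z) \<partial>\<mu>) - (\<integral>z. f (x - z) \<partial>\<mu>)
        - (y - x) \<bullet> (\<integral>z. g (x - z) \<partial>\<mu>)) /\<^sub>R norm (y - x)" for y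
      using intf intg by simp
    ultimately show "((\<lambda>y. ((\<integral>z. f (y - z) \<partial>\<mu>) - (\<integral>z. f (x - z) \<partial>\<mu>)
        - (y - x) \<bullet> (\<integral>z. g (x - z) \<partial>\<mu>)) /\<^sub>R norm (y - x)) \<circ> X) \<longlonglongrightarrow> 0"
      by (simp only: o_def Bochner_Integration.integral_zero)
  qed
qed

text \<open>Translation invariance of Lebesgue measure moves the shift by \<open>z\<close> from the
  set into the density, and Tonelli exchanges the integrals. Boundedness of \<open>f\<close> makes
  the inner integral finite, so that it may be written as a real integral.\<close>

lemma convolution_density_lborel:
  fixes f :: "'a::ordered_euclidean_space \<Rightarrow> real"
  assumes "finite_measure \<mu>" and sets[measurable_cong, simp]: "sets \<mu> = sets borel"
    and "finite_measure (density lborel (\<lambda>x. ennreal (f x)))"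
    and f[measurable]: "f \<in> borel_measurable borel" and "\<And>y. 0 \<le> f y" and bf: "\<And>y. f y \<le> C"
  shows "\<mu> \<star> density lborel (\<lambda>x. ennreal (f x)) = density lborel (\<lambda>x. ennreal (\<integral>z. f (x - z) \<partial>\<mu>))"
proof (rule measure_eqI)
  interpret finite_measure \<mu> by fact
  interpret L: pair_sigma_finite \<mu> "lborel :: 'a measure" ..
  fix A assume "A \<in> sets (\<mu> \<star> density lborel (\<lambda>x. ennreal (f x)))"
  then have [measurable]: "A \<in> sets borel" by simp
  have "emeasure (\<mu> \<star> density lborel (\<lambda>x. ennreal (f x))) A
      = (\<integral>\<^sup>+z. \<integral>\<^sup>+y. indicator A (z + y) \<partial>density lborel (\<lambda>x. ennreal (f x)) \<partial>\<mu>)"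
    by (rule convolution_emeasure') (use assms in auto)
  also have "\<dots> = (\<integral>\<^sup>+z. \<integral>\<^sup>+x. ennreal (f (x - z)) * indicator A x \<partial>lborel \<partial>\<mu>)"
  proof (rule nn_integral_cong)
    fix z
    have "(\<integral>\<^sup>+x. ennreal (f (x - z)) * indicator A x \<partial>lborel)
        = (\<integral>\<^sup>+x. ennreal (f (x - z)) * indicator A x \<partial>distr lborel borel ((+) z))"
      by (simp add: lborel_distr_plus)
    then show "(\<integral>\<^sup>+y. indicator A (z + y) \<partial>density lborel (\<lambda>x. ennreal (f x)))
        = (\<integral>\<^sup>+x. ennreal (f (x - z)) * indicator A x \<partial>lborel)"
      by (simp add: nn_integral_density nn_integral_distr)
  qed
  also have "\<dots> = (\<integral>\<^sup>+x. \<integral>\<^sup>+z. ennreal (f (x - z)) * indicator A x \<partial>\<mu> \<partial>lborel)"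
    by (rule L.Fubini'[symmetric]) measurable
  also have "\<dots> = (\<integral>\<^sup>+x. ennreal (\<integral>z. f (x - z) \<partial>\<mu>) * indicator A x \<partial>lborel)"
  proof (rule nn_integral_cong)
    fix x
    have "integrable \<mu> (\<lambda>z. f (x - z))"
      by (rule integrable_const_bound[where B=C]) (use assms in auto)
    then have "(\<integral>\<^sup>+z. ennreal (f (x - z)) \<partial>\<mu>) = ennreal (\<integral>z. f (x - z) \<partial>\<mu>)"
      using assms by (intro nn_integral_eq_integral) auto
    then show "(\<integral>\<^sup>+z. ennreal (f (x - z)) * indicator A x \<partial>\<mu>) = ennreal (\<integral>z. f (x - z) \<partial>\<mu>) * indicator A x"
      by (simp add: nn_integral_multc)
  qed
  also have "\<dots> = emeasure (density lborel (\<lambda>x. ennreal (\<integral>z. f (x - z) \<partial>\<mu>))) A"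
    by (simp add: emeasure_density)
  finally show "emeasure (\<mu> \<star> density lborel (\<lambda>x. ennreal (f x))) A
      = emeasure (density lborel (\<lambda>x. ennreal (\<integral>z. f (x - z) \<partial>\<mu>))) A" .
qed simp

text \<open>Two densities of one measure agree almost everywhere; by continuity the set of agreement
  is closed, and a closed set of full Lebesgue measure is the whole space.\<close>

lemma continuous_density_unique:
  assumes p: "continuous_density \<mu> p" and q: "continuous_density \<mu> q"
  shows "p = q"
proof
  fix x
  have cont: "continuous_on UNIV p" "continuous_on UNIV q" and nn: "\<And>x. 0 \<le> p x" "\<And>x. 0 \<le> q x"
    using p q by (auto simp: continuous_density_def)
  then have [measurable]: "p \<in> borel_measurable borel" "q \<in> borel_measurable borel"
    by (auto intro: borel_measurable_continuous_onI)
  have "density lborel (\<lambda>x. ennreal (p x)) = density lborel (\<lambda>x. ennreal (q x))"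
    using p q by (simp add: continuous_density_def)
  then have "AE x in lborel. ennreal (p x) = ennreal (q x)"
    by (subst (asm) sigma_finite_measure.density_unique_iff[OF sigma_finite_lborel]) auto
  then have "AE x in lborel. x \<in> {x. p x = q x}"
    using nn by simp
  then have "AE x in lebesgue. x \<in> {x. p x = q x}"
    by (rule AE_completion)
  moreover have "closed {x. p x = q x}"
    using cont by (rule closed_Collect_eq)
  ultimately show "p x = q x"
    using mem_closed_if_AE_lebesgue by blast
qed

section \<open>Gaussian smoothing\<close>

definition gaussian_density :: "real \<Rightarrow> real ^ 'd \<Rightarrow> real" where
  "gaussian_density t y = (\<Prod>i\<in>UNIV. normal_density 0 (sqrt t) (y $ i))"

lemma gaussian_density_eq:
  fixes y :: "real ^ 'd"
  assumes "0 < t"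
  shows "gaussian_density t y = (1 / sqrt (2 * pi * t)) ^ CARD('d) * exp (- (y \<bullet> y) / (2 * t))"
proof -
  have "gaussian_density t y = (1 / sqrt (2 * pi * t)) ^ CARD('d) * (\<Prod>i\<in>UNIV. exp (- (y $ i)\<^sup>2 / (2 * t)))"
    using assms by (simp add: gaussian_density_def normal_density_def prod.distrib prod_dividef power_one_over)
  also have "(\<Prod>i\<in>UNIV. exp (- (y $ i)\<^sup>2 / (2 * t))) = exp (\<Sum>i\<in>UNIV. - (y $ i)\<^sup>2 / (2 * t))"
    by (simp add: exp_sum)
  also have "(\<Sum>i\<in>UNIV. - (y $ i)\<^sup>2 / (2 * t)) = - (y \<bullet> y) / (2 * t)"
    by (simp add: inner_vec_def power2_eq_square sum_divide_distrib sum_negf)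
  finally show ?thesis .
qed

lemma gaussian_density_pos: "0 < t \<Longrightarrow> 0 < gaussian_density t y"
  by (simp add: gaussian_density_eq)

lemma GDERIV_gaussian_density:
  assumes "0 < t"
  shows "GDERIV (gaussian_density t) y :> - (gaussian_density t y / t) *\<^sub>R y"
  unfolding gderiv_def
  by (subst gaussian_density_eq[OF assms, abs_def])
     (use assms in \<open>auto intro!: derivative_eq_intros ext simp: gaussian_density_eq inner_commute field_simps\<close>)

text \<open>The gradient is bounded because \<open>norm y\<close> is dominated by the exponential of
  its scaled square. A single \<open>C\<close> serves both bounds, as
  \<open>GDERIV_integral_translate\<close> expects.\<close>

lemma gaussian_density_bounded:
  assumes "0 < t"
  obtains C where "\<And>y :: real ^ 'd. gaussian_density t y \<le> C"
    and "\<And>y :: real ^ 'd. norm (- (gaussian_density t y / t) *\<^sub>R y) \<le> C"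
proof -
  define c where "c = (1 / sqrt (2 * pi * t)) ^ CARD('d)"
  have c: "0 < c" using assms by (simp add: c_def)
  have eq: "gaussian_density t y = c * exp (- (norm y)\<^sup>2 / (2 * t))" for y :: "real ^ 'd"
    using assms by (simp add: gaussian_density_eq c_def power2_norm_eq_inner)
  have 1: "gaussian_density t y \<le> c" for y :: "real ^ 'd"
    using assms c by (simp add: eq)
  have 2: "norm (- (gaussian_density t y / t) *\<^sub>R y) \<le> c * (2 * t + 1) / t" for y :: "real ^ 'd"
  proof -
    let ?r = "norm y" and ?E = "exp ((norm y)\<^sup>2 / (2 * t))"
    have "?r \<le> 1 + ?r\<^sup>2"
      using zero_le_power2[of "?r - 1"] by (simp add: power2_diff) (smt (verit) zero_le_power2)
    \<comment> \<open>The factor \<open>2 * t + 1\<close> is at least 1 for the constant term and at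
      least \<open>2 * t\<close> for the quadratic one; the next step is
      \<open>1 + u \<le> exp u\<close>.\<close>
    also have "\<dots> \<le> (2 * t + 1) * (1 + ?r\<^sup>2 / (2 * t))"
      using assms by (simp add: field_simps)
    also have "\<dots> \<le> (2 * t + 1) * ?E"
      using assms by (intro mult_left_mono) auto
    finally have "?r / ?E \<le> 2 * t + 1"
      by (simp add: divide_le_eq)
    then have "?r * exp (- ?r\<^sup>2 / (2 * t)) \<le> 2 * t + 1"
      by (simp add: exp_minus field_simps)
    then have "c * (?r * exp (- ?r\<^sup>2 / (2 * t))) / t \<le> c * (2 * t + 1) / t"
      using c assms by (intro divide_right_mono mult_left_mono) auto
    then show ?thesis
      using c assms by (simp add: eq abs_mult mult_ac)
  qed
  show ?thesis
    by (rule that[of "max c (c * (2 * t + 1) / t)"]) (use 1 2 in \<open>auto intro: max.coboundedI1 max.coboundedI2\<close>)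
qed

lemma gaussian_eq: "gaussian t = density lborel (\<lambda>x. ennreal (gaussian_density t x))"
  by (simp add: gaussian_def gaussian_density_def)

text \<open>The explicit mixture \<open>q\<close> of translated Gaussian densities is the continuous
  density of the convolution. Its positivity permits taking the logarithm, and the integrability
  facts permit moving a linear map inside the gradient integral.\<close>

lemma gaussian_smoothing:
  fixes \<mu> :: "(real ^ 'd) measure"
  assumes "prob_space \<mu>" and sets[measurable_cong]: "sets \<mu> = sets borel"
    and "finite_measure (gaussian t :: (real ^ 'd) measure)" and t: "0 < t"
  defines "q \<equiv> \<lambda>x. \<integral>z. gaussian_density t (x - z) \<partial>\<mu>"
  shows "continuous_density (\<mu> \<star> gaussian t) q"
    and "0 < q x"
    and "integrable \<mu> (\<lambda>z. gaussian_density t (x - z))"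
    and "integrable \<mu> (\<lambda>z. - (gaussian_density t (x - z) / t) *\<^sub>R (x - z))"
    and "GDERIV q x :> (\<integral>z. - (gaussian_density t (x - z) / t) *\<^sub>R (x - z) \<partial>\<mu>)"
proof -
  interpret prob_space \<mu> by fact
  note pos = gaussian_density_pos[OF t]
  obtain C where C: "\<And>y :: real ^ 'd. gaussian_density t y \<le> C"
    and C': "\<And>y :: real ^ 'd. norm (- (gaussian_density t y / t) *\<^sub>R y) \<le> C"
    using gaussian_density_bounded[OF t] by blast
  have aC: "\<bar>gaussian_density t y\<bar> \<le> C" for y :: "real ^ 'd"
    using C[of y] pos[of y] by simp
  have [measurable]: "(gaussian_density t :: real ^ 'd \<Rightarrow> real) \<in> borel_measurable borel"
    unfolding gaussian_density_def[abs_def] by measurable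
  have D: "GDERIV q x :> (\<integral>z. - (gaussian_density t (x - z) / t) *\<^sub>R (x - z) \<partial>\<mu>)" for x
    unfolding q_def
    by (rule GDERIV_integral_translate[OF finite_measure_axioms sets GDERIV_gaussian_density[OF t] aC C'])
       measurable
  then show "GDERIV q x :> (\<integral>z. - (gaussian_density t (x - z) / t) *\<^sub>R (x - z) \<partial>\<mu>)" .
  show int: "integrable \<mu> (\<lambda>z. gaussian_density t (x - z))" for x
    by (rule integrable_const_bound[where B=C]) (auto simp: aC)
  show "integrable \<mu> (\<lambda>z. - (gaussian_density t (x - z) / t) *\<^sub>R (x - z))"
    by (rule integrable_const_bound[where B=C]) (auto simp: C' simp del: norm_scaleR scaleR_minus_left)
  show qpos: "0 < q x" for x
    unfolding q_def by (rule expectation_greater[OF int]) (simp add: pos)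
  have "continuous_on UNIV q"
    using D by (auto simp: gderiv_def intro: continuous_at_imp_continuous_on has_derivative_continuous)
  moreover have "\<mu> \<star> gaussian t = density lborel (\<lambda>x. ennreal (q x))"
    unfolding gaussian_eq q_def
    by (rule convolution_density_lborel[OF finite_measure_axioms sets _ _ _ C])
       (use assms pos less_imp_le in \<open>auto simp: gaussian_eq\<close>)
  ultimately show "continuous_density (\<mu> \<star> gaussian t) q"
    using qpos by (simp add: continuous_density_def less_imp_le)
qed

section \<open>The projected score of the conditional law\<close>

theorem mainTheorem4:
  fixes M :: "'a measure"
    and Z :: "'a \<Rightarrow> real ^ 'd"
    and W :: "real \<Rightarrow> 'a \<Rightarrow> real ^ 'd"
    and A :: "real ^ 'd ^ 'm"
    and \<kappa> :: "real ^ 'd \<Rightarrow> (real ^ 'd) measure"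
    and b :: "real ^ 'd"
  assumes "prob_space M"
    and "Z \<in> borel_measurable M"
    and "rank A = CARD('m)"
    and "standard_brownian_motion M W"
    and "process_indep_of M W Z"
    and "regular_conditional_distribution M Z (\<lambda>\<omega>. P_perp A *v Z \<omega>) \<kappa>"
    and "AE z in \<kappa> b. P_perp A *v z = b"
  shows "\<forall>t>0.
      regular_conditional_distribution M (\<lambda>\<omega>. Z \<omega> + W t \<omega>) (\<lambda>\<omega>. P_perp A *v Z \<omega>) (cond_law_X \<kappa> t)
    \<and> (\<exists>!p. continuous_density (cond_law_X \<kappa> t b) p)
    \<and> (\<forall>p x. continuous_density (cond_law_X \<kappa> t b) p \<longrightarrow>
          0 < p x
        \<and> (\<lambda>y. ln (p y)) differentiable (at x)
        \<and> P_perp A *v score p x = (1 / t) *\<^sub>R (P_perp A *v (b - x)))"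
proof (intro allI impI)
  fix t :: real assume t: "0 < t"
  let ?P = "P_perp A"
  have W: "W s \<in> borel_measurable M" if "0 \<le> s" for s
    using assms(4) that by (simp add: standard_brownian_motion_def)
  have law: "distr M borel (W t) = gaussian t"
    by (rule brownian_motion_distr[OF assms(4) t])
  \<comment> \<open>Finiteness of \<open>gaussian t\<close> is read off from its being the law of
    \<open>W t\<close>.\<close>
  have "prob_space (distr M borel (W t))"
    using assms(1) W t by (simp add: prob_space.prob_space_distr)
  then have fin: "finite_measure (gaussian t :: (real ^ 'd) measure)"
    by (simp add: law prob_space.finite_measure)
  have "prob_space.indep_var M borel Z borel (W t)"
    using t by (intro process_indep_of_indep_var[OF assms(1,2,5) W]) auto
  moreover have "(*v) ?P \<in> borel_measurable borel"
    by (intro borel_measurable_continuous_onI linear_continuous_on matrix_vector_mul_bounded_linear)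
  ultimately have rcd: "regular_conditional_distribution M (\<lambda>\<omega>. Z \<omega> + W t \<omega>) (\<lambda>\<omega>. ?P *v Z \<omega>) (cond_law_X \<kappa> t)"
    using regular_conditional_distribution_add_indep[OF assms(1) _ _ assms(6), of "W t"]
    by (simp add: law cond_law_X_def[abs_def])
  have "\<kappa> \<in> borel \<rightarrow>\<^sub>M prob_algebra borel"
    using assms(6) by (simp add: regular_conditional_distribution_def)
  from measurable_space[OF this, of b]
  have ps: "prob_space (\<kappa> b)" and sets: "sets (\<kappa> b) = sets borel"
    by (auto simp: space_prob_algebra)
  interpret \<kappa>: prob_space "\<kappa> b" by (rule ps)
  define q where "q = (\<lambda>x. \<integral>z. gaussian_density t (x - z) \<partial>\<kappa> b)"
  note smooth = gaussian_smoothing[OF ps sets fin t, folded q_def]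
  have q: "continuous_density (cond_law_X \<kappa> t b) q"
    unfolding cond_law_X_def by (rule smooth)
  have qpos: "0 < q x" for x
    using smooth(2) by (simp add: q_def)
  \<comment> \<open>An almost sure property under a probability measure has a witness, so
    \<open>b\<close> lies in the range of the projection and is fixed by it.\<close>
  have "\<exists>z. ?P *v z = b"
  proof (rule ccontr)
    assume "\<not> ?thesis"
    then have "AE z in \<kappa> b. False" using assms(7) by simp
    then show False by simp
  qed
  then have Pb: "?P *v b = b"
    using P_perp_idem[OF assms(3)] by (metis matrix_vector_mul_assoc)
  have score: "(\<lambda>y. ln (q y)) differentiable (at x) \<and> ?P *v score q x = (1 / t) *\<^sub>R (?P *v (b - x))" for x
  proof -
    let ?g = "\<lambda>z. - (gaussian_density t (x - z) / t) *\<^sub>R (x - z)"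
    have ln: "GDERIV (\<lambda>y. ln (q y)) x :> (1 / q x) *\<^sub>R (\<integral>z. ?g z \<partial>\<kappa> b)"
      by (rule GDERIV_DERIV_compose[OF smooth(5)]) (use qpos[of x] in \<open>auto intro!: derivative_eq_intros\<close>)
    have "?P *v (\<integral>z. ?g z \<partial>\<kappa> b) = (\<integral>z. ?P *v ?g z \<partial>\<kappa> b)"
      by (rule integral_bounded_linear[OF matrix_vector_mul_bounded_linear smooth(4), symmetric])
    also have "\<dots> = (\<integral>z. gaussian_density t (x - z) *\<^sub>R ((1 / t) *\<^sub>R (?P *v (b - x))) \<partial>\<kappa> b)"
    proof (rule integral_cong_AE)
      have [measurable]: "(*v) ?P \<in> borel_measurable borel" by fact
      show "(\<lambda>z. ?P *v ?g z) \<in> borel_measurable (\<kappa> b)"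
        using borel_measurable_integrable[OF smooth(4)] by measurable
      show "(\<lambda>z. gaussian_density t (x - z) *\<^sub>R ((1 / t) *\<^sub>R (?P *v (b - x)))) \<in> borel_measurable (\<kappa> b)"
        using borel_measurable_integrable[OF smooth(3)] by measurable
      show "AE z in \<kappa> b. ?P *v ?g z = gaussian_density t (x - z) *\<^sub>R ((1 / t) *\<^sub>R (?P *v (b - x)))"
        using assms(7)
      proof eventually_elim
        fix z assume "?P *v z = b"
        \<comment> \<open>Both sides equal \<open>b - ?P *v x\<close>, which no longer depends on
          \<open>z\<close>; hence the vector factor leaves the integral.\<close>
        then have "?P *v (b - x) = - (?P *v (x - z))"
          by (simp add: matrix_vector_mult_diff_distrib Pb)
        then show "?P *v ?g z = gaussian_density t (x - z) *\<^sub>R ((1 / t) *\<^sub>R (?P *v (b - x)))"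
          by (simp only: matrix_vector_mult_scaleR) simp
      qed
    qed
    also have "\<dots> = q x *\<^sub>R ((1 / t) *\<^sub>R (?P *v (b - x)))"
      using smooth(3) by (simp add: q_def)
    finally have "?P *v ((1 / q x) *\<^sub>R (\<integral>z. ?g z \<partial>\<kappa> b)) = (1 / t) *\<^sub>R (?P *v (b - x))"
      using qpos[of x] by (simp only: matrix_vector_mult_scaleR) simp
    then show ?thesis
      using ln by (auto simp: score_def gradient_eqI[OF ln] gderiv_def differentiable_def)
  qed
  show "regular_conditional_distribution M (\<lambda>\<omega>. Z \<omega> + W t \<omega>) (\<lambda>\<omega>. P_perp A *v Z \<omega>) (cond_law_X \<kappa> t)
    \<and> (\<exists>!p. continuous_density (cond_law_X \<kappa> t b) p)
    \<and> (\<forall>p x. continuous_density (cond_law_X \<kappa> t b) p \<longrightarrow>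
          0 < p x
        \<and> (\<lambda>y. ln (p y)) differentiable (at x)
        \<and> P_perp A *v score p x = (1 / t) *\<^sub>R (P_perp A *v (b - x)))"
    \<comment> \<open>Uniqueness identifies every continuous density \<open>p\<close> with
      \<open>q\<close>, for which the claims were proved.\<close>
    using rcd q score qpos continuous_density_unique[OF q] by blast
qed

end
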